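(* Let $r>0$ and let $f(z)=\sum_{n\ge0}a_nz^n\in\mathcal A_{\mathcal R(p,q),r}$. Then for every integer $m\ge0$ and every $n\ge0$, $$|a_n|\le\frac{\|f\|_{\mathcal R(p,q),r}}{\mathcal R(p^n,q^n)\,r^n},\qquad |f^{(m)}(0)|=m!\,|a_m|\le m!\,\frac{\|f\|_{\mathcal R(p,q),r}}{\mathcal R(p^m,q^m)\,r^m}.$$ Moreover, for any $0<\rho<r$, $$\sup_{|z|\le\rho}|f(z)|\le\frac{\|f\|_{\mathcal R(p,q),r}}{\min_{n\ge0}\{\mathcal R(p^n,q^n)\}}\sum_{n=0}^\infty\Big(\frac{\rho}{r}\Big)^n.$$ If in addition there exist constants $C_1,C_2>0$, $\Lambda\ge\lambda>0$ and $n_0\in\mathbb N$ such that $C_1e^{\lambda n}\le\mathcal R(p^n,q^n)\le C_2e^{\Lambda n}$ for all $n\ge n_0$, then there exists a constant $C(\mathcal R(p,q),r,\rho)$, depending only on these growth bounds, $r$ and $\rho$, such that $$\sup_{|z|\le\rho}|f(z)|\le C(\mathcal R(p,q),r,\rho)\,\|f\|_{\mathcal R(p,q),r}.$$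
   Context: $0<q<p\le1$, and $\mathcal R(u,v)=\sum_{s,t=-\ell}^{\infty}r_{st}u^sv^t$ (with $\ell\ge0$ an integer) is a deformation kernel such that $\mathcal R(p^n,q^n)>0$ for all integers $n\ge0$. The coefficients $a_n$ are complex numbers. For $f(z)=\sum_{n\ge0}a_nz^n$ analytic at the origin and $r>0$, the weighted $\mathcal R(p,q)$-norm is $$\|f\|_{\mathcal R(p,q),r}:=\sum_{n=0}^\infty|a_n|\,\mathcal R(p^n,q^n)\,r^n,$$ and $\mathcal A_{\mathcal R(p,q),r}$ is the Banach space of power series with $\|f\|_{\mathcal R(p,q),r}<\infty$.
   Formalization: The constant C may also depend on the finitely many values R(p^n,q^n), n<n_0, since dependence on the growth bounds, r and ρ alone is false (R=u^{-1}-(1-ε), n_0=1, f=1/ε); the minimum, which need not exist, is read as the infimum. *)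

theory Defs
  imports "HOL-Analysis.Analysis"
begin

text \<open>
  The kernel R(u,v) is given by its Laurent coefficients \<open>c s t\<close> with \<open>s, t \<ge> - l\<close>. The double
  series is summed unconditionally; the coefficients may be complex.
\<close>

definition kernel_term :: "(int \<Rightarrow> int \<Rightarrow> complex) \<Rightarrow> complex \<Rightarrow> complex \<Rightarrow> int \<times> int \<Rightarrow> complex" where
  "kernel_term c u v = (\<lambda>(s, t). c s t * u powi s * v powi t)"

definition kernel_index :: "nat \<Rightarrow> (int \<times> int) set" where
  "kernel_index l = {- int l..} \<times> {- int l..}"

definition kernel :: "nat \<Rightarrow> (int \<Rightarrow> int \<Rightarrow> complex) \<Rightarrow> complex \<Rightarrow> complex \<Rightarrow> complex" where
  "kernel l c u v = infsum (kernel_term c u v) (kernel_index l)"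

text \<open>
  Positivity of R at \<open>(p ^ n, q ^ n)\<close> means that the (a priori complex) value is real and positive.
\<close>

definition deformation_kernel :: "real \<Rightarrow> real \<Rightarrow> nat \<Rightarrow> (int \<Rightarrow> int \<Rightarrow> complex) \<Rightarrow> bool" where
  "deformation_kernel p q l c \<longleftrightarrow>
     0 < q \<and> q < p \<and> p \<le> 1 \<and>
     (\<forall>n. kernel_term c (of_real (p ^ n)) (of_real (q ^ n)) summable_on kernel_index l \<and>
          kernel l c (of_real (p ^ n)) (of_real (q ^ n)) \<in> \<real> \<and>
          0 < Re (kernel l c (of_real (p ^ n)) (of_real (q ^ n))))"

definition weight :: "real \<Rightarrow> real \<Rightarrow> nat \<Rightarrow> (int \<Rightarrow> int \<Rightarrow> complex) \<Rightarrow> nat \<Rightarrow> real" where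
  "weight p q l c n = Re (kernel l c (of_real (p ^ n)) (of_real (q ^ n)))"

text \<open>
  Functions analytic at the origin are represented by power series with positive radius of
  convergence; the function itself is \<open>eval_fps F\<close>.
\<close>

definition rpq_norm ::
  "real \<Rightarrow> real \<Rightarrow> nat \<Rightarrow> (int \<Rightarrow> int \<Rightarrow> complex) \<Rightarrow> real \<Rightarrow> complex fps \<Rightarrow> real" where
  "rpq_norm p q l c r F = (\<Sum>n. norm (fps_nth F n) * weight p q l c n * r ^ n)"

definition rpq_space ::
  "real \<Rightarrow> real \<Rightarrow> nat \<Rightarrow> (int \<Rightarrow> int \<Rightarrow> complex) \<Rightarrow> real \<Rightarrow> complex fps set" where
  "rpq_space p q l c r =
     {F. fps_conv_radius F > 0 \<and> summable (\<lambda>n. norm (fps_nth F n) * weight p q l c n * r ^ n)}"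

text \<open>
  The supremum is taken in \<^typ>\<open>ennreal\<close>, so an upper bound for it includes boundedness. It is
  meaningful only if the power series converges on the closed disc, as \<open>eval_fps\<close> is unspecified
  where the series diverges.
\<close>

definition disc_sup :: "real \<Rightarrow> complex fps \<Rightarrow> ennreal" where
  "disc_sup \<rho> F = (SUP z\<in>cball 0 \<rho>. ennreal (norm (eval_fps F z)))"

end

theory Submission imports Defs begin

text \<open>
  Every term of the norm series is nonnegative, so each one is at most the whole sum; that is the
  coefficient estimate (\<open>coeff_le_rpq_norm\<close>), and the derivatives at the origin are the coefficients
  up to a factorial.

  The disc estimates rest on a positive lower bound \<open>d\<close> of the weights. It gives
  \<open>\<Sum> |a\<^sub>n| r\<^sup>n \<le> N / d\<close>, where \<open>N\<close> is the norm, so the power series converges absolutely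
  on the closed disc of radius \<open>r\<close> and is bounded there by \<open>N / d\<close> (\<open>conv_radius_ge_if_weight_ge\<close>,
  \<open>disc_sup_le_if_weight_ge\<close>). The infimum of the weights is such a \<open>d\<close> if it is positive, and the
  geometric factor is at least its first term \<open>1\<close>. If the infimum is \<open>0\<close>, the quotient by it is
  infinite, unless the norm vanishes, in which case the series is \<open>0\<close>.

  Under exponential growth the weights from \<open>n\<^sub>0\<close> on are at least \<open>C\<^sub>1\<close>, because \<open>\<lambda> > 0\<close>, and the
  finitely many earlier ones are the entries of a prescribed list. The smallest of these
  numbers is therefore a common \<open>d\<close> for all kernels that share the growth data and the list.
\<close>

lemma weight_pos: "deformation_kernel p q l c \<Longrightarrow> 0 < weight p q l c n"
  by (simp add: deformation_kernel_def weight_def)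

lemma term_le_rpq_norm:
  assumes "deformation_kernel p q l c" and "F \<in> rpq_space p q l c r" and "r > 0"
  shows "norm (fps_nth F n) * weight p q l c n * r ^ n \<le> rpq_norm p q l c r F"
proof -
  let ?t = "\<lambda>n. norm (fps_nth F n) * weight p q l c n * r ^ n"
  have "summable ?t"
    using assms(2) by (simp add: rpq_space_def)
  moreover have "0 \<le> ?t m" for m
    using weight_pos[OF assms(1), of m] assms(3) by simp
  ultimately have "sum ?t {n} \<le> suminf ?t"
    by (intro sum_le_suminf) auto
  then show ?thesis
    by (simp add: rpq_norm_def)
qed

lemma coeff_le_rpq_norm:
  assumes "deformation_kernel p q l c" and "F \<in> rpq_space p q l c r" and "r > 0"
  shows "norm (fps_nth F n) \<le> rpq_norm p q l c r F / (weight p q l c n * r ^ n)"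
  using term_le_rpq_norm[OF assms, of n] weight_pos[OF assms(1), of n] assms(3)
  by (simp add: pos_le_divide_eq mult.assoc)

lemma rpq_norm_nonneg:
  assumes "deformation_kernel p q l c" and "F \<in> rpq_space p q l c r" and "r > 0"
  shows "0 \<le> rpq_norm p q l c r F"
proof -
  have "0 \<le> norm (fps_nth F 0) * weight p q l c 0 * r ^ 0"
    using weight_pos[OF assms(1), of 0] by simp
  also have "\<dots> \<le> rpq_norm p q l c r F"
    by (rule term_le_rpq_norm[OF assms])
  finally show ?thesis .
qed

lemma rpq_norm_eq_0_imp:
  assumes "deformation_kernel p q l c" and "F \<in> rpq_space p q l c r" and "r > 0"
    and "rpq_norm p q l c r F = 0"
  shows "F = 0"
  using coeff_le_rpq_norm[OF assms(1-3)] assms(4) by (simp add: fps_eq_iff)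

lemma norm_deriv_eval_fps_0:
  fixes F :: "complex fps"
  assumes "fps_conv_radius F > 0"
  shows "norm ((deriv ^^ m) (eval_fps F) 0) = fact m * norm (fps_nth F m)"
  using fps_nth_conv_deriv[OF assms, of m] by (simp add: norm_divide)

text \<open>
  Comparison with the norm series: dropping a weight that is at least \<open>d\<close> costs a factor \<open>1 / d\<close>.
\<close>

lemma abs_series_le_if_weight_ge:
  assumes "F \<in> rpq_space p q l c r" and "r > 0" and "d > 0" and "\<And>n. d \<le> weight p q l c n"
  shows "summable (\<lambda>n. norm (fps_nth F n) * r ^ n)"
    and "(\<Sum>n. norm (fps_nth F n) * r ^ n) \<le> rpq_norm p q l c r F / d"
proof -
  let ?t = "\<lambda>n. norm (fps_nth F n) * weight p q l c n * r ^ n"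
  have t: "summable (\<lambda>n. ?t n / d)"
    using assms(1) by (auto simp: rpq_space_def intro: summable_divide)
  have le: "norm (fps_nth F n) * r ^ n \<le> ?t n / d" for n
  proof -
    have "(norm (fps_nth F n) * r ^ n) * d \<le> (norm (fps_nth F n) * r ^ n) * weight p q l c n"
      using assms(2,4) by (intro mult_left_mono) auto
    then show ?thesis
      using assms(3) by (simp add: pos_le_divide_eq mult_ac)
  qed
  show *: "summable (\<lambda>n. norm (fps_nth F n) * r ^ n)"
    by (rule summable_comparison_test'[OF t, of 0]) (use le assms(2) in auto)
  have "(\<Sum>n. norm (fps_nth F n) * r ^ n) \<le> (\<Sum>n. ?t n / d)"
    by (rule suminf_le[OF le * t])
  also have "\<dots> = rpq_norm p q l c r F / d"
    unfolding rpq_norm_def using assms(1) by (intro suminf_divide) (simp add: rpq_space_def)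
  finally show "(\<Sum>n. norm (fps_nth F n) * r ^ n) \<le> rpq_norm p q l c r F / d" .
qed

lemma conv_radius_ge_if_weight_ge:
  assumes "F \<in> rpq_space p q l c r" and "r > 0" and "d > 0" and "\<And>n. d \<le> weight p q l c n"
  shows "ereal r \<le> fps_conv_radius F"
proof -
  have "summable (\<lambda>n. norm (fps_nth F n * of_real r ^ n))"
    using abs_series_le_if_weight_ge(1)[OF assms] assms(2) by (simp add: norm_mult norm_power)
  then have "summable (\<lambda>n. fps_nth F n * of_real r ^ n)"
    by (rule summable_norm_cancel)
  from conv_radius_geI[OF this] show ?thesis
    using assms(2) by (simp add: fps_conv_radius_def)
qed

lemma disc_sup_le_if_weight_ge:
  assumes "F \<in> rpq_space p q l c r" and "r > 0" and "d > 0" and "\<And>n. d \<le> weight p q l c n"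
    and "\<rho> \<le> r"
  shows "disc_sup \<rho> F \<le> ennreal (rpq_norm p q l c r F / d)"
  unfolding disc_sup_def
proof (intro SUP_least ennreal_leI)
  fix z :: complex
  assume "z \<in> cball 0 \<rho>"
  then have z: "norm z \<le> r"
    using assms(5) by simp
  note r = abs_series_le_if_weight_ge[OF assms(1-4)]
  have le: "norm (fps_nth F n * z ^ n) \<le> norm (fps_nth F n) * r ^ n" for n
    using z by (auto simp: norm_mult norm_power intro!: mult_left_mono power_mono)
  have s: "summable (\<lambda>n. norm (fps_nth F n * z ^ n))"
    by (rule summable_comparison_test'[OF r(1), of 0]) (use le in auto)
  have "norm (eval_fps F z) \<le> (\<Sum>n. norm (fps_nth F n * z ^ n))"
    unfolding eval_fps_def by (rule summable_norm[OF s])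
  also have "\<dots> \<le> (\<Sum>n. norm (fps_nth F n) * r ^ n)"
    by (rule suminf_le[OF le s r(1)])
  also note r(2)
  finally show "norm (eval_fps F z) \<le> rpq_norm p q l c r F / d" .
qed

lemma less_conv_radius_if_INF_weight_pos:
  assumes "deformation_kernel p q l c" and "F \<in> rpq_space p q l c r" and "r > 0"
    and "(INF n. weight p q l c n) > 0" and "\<rho> < r"
  shows "ereal \<rho> < fps_conv_radius F"
proof -
  have "bdd_below (range (weight p q l c))"
    using weight_pos[OF assms(1)] by (intro bdd_belowI[of _ 0]) (auto intro: less_imp_le)
  then have "(INF n. weight p q l c n) \<le> weight p q l c n" for n
    by (rule cINF_lower) simp
  from conv_radius_ge_if_weight_ge[OF assms(2-4) this] show ?thesis
    using assms(5) by (meson ereal_less(2) less_ereal.simps(1) less_le_trans)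
qed

lemma disc_sup_le_INF_weight:
  assumes "deformation_kernel p q l c" and "F \<in> rpq_space p q l c r" and "r > 0" and "\<rho> \<le> r"
  shows "disc_sup \<rho> F \<le> ennreal (rpq_norm p q l c r F) / (INF n. ennreal (weight p q l c n))"
proof -
  let ?N = "rpq_norm p q l c r F" and ?W = "INF n. ennreal (weight p q l c n)"
  consider "?N = 0" | "?N > 0" "?W = 0" | "?W \<noteq> 0"
    using rpq_norm_nonneg[OF assms(1-3)] by fastforce
  then show ?thesis
  proof cases
    case 1
    then have "F = 0"
      by (rule rpq_norm_eq_0_imp[OF assms(1-3)])
    then show ?thesis
      unfolding disc_sup_def by (intro SUP_least) simp
  next
    case 2
    \<comment> \<open>A positive number divided by \<open>0\<close> is \<open>\<top>\<close>.\<close>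
    then show ?thesis
      by (simp add: ennreal_divide_zero)
  next
    case 3
    have le: "?W \<le> ennreal (weight p q l c n)" for n
      by (rule INF_lower) simp
    then have "?W < top"
      using le_less_trans ennreal_less_top by blast
    then obtain d where d: "?W = ennreal d" "0 \<le> d"
      by (cases ?W) auto
    have "d > 0"
      using 3 d by (cases "d = 0") auto
    moreover have "d \<le> weight p q l c n" for n
      using le[of n] d weight_pos[OF assms(1), of n] by (simp add: ennreal_le_iff)
    ultimately have "disc_sup \<rho> F \<le> ennreal (?N / d)"
      by (intro disc_sup_le_if_weight_ge[OF assms(2,3)] assms(4))
    also have "\<dots> = ennreal ?N / ?W"
      using d \<open>d > 0\<close> rpq_norm_nonneg[OF assms(1-3)] by (simp add: divide_ennreal)
    finally show ?thesis .
  qed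
qed

lemma one_le_geometric_ennreal:
  fixes x :: real
  shows "1 \<le> (\<Sum>n. ennreal (x ^ n))"
proof -
  have "(\<Sum>n\<in>{0}. ennreal (x ^ n)) \<le> (\<Sum>n. ennreal (x ^ n))"
    by (rule sum_le_suminf) auto
  then show ?thesis
    by simp
qed

text \<open>
  The bound depends on the growth data and the list of initial values alone. Nonpositive list entries
  are left out of the minimum to keep it positive also for lists that no kernel realises.
\<close>

lemma common_weight_bound:
  fixes C1 lam :: real
  assumes "0 < C1" and "0 < lam"
  obtains d where "d > 0"
    and "\<And>p q l c n. deformation_kernel p q l c \<Longrightarrow>
           \<forall>n\<ge>n0. C1 * exp (lam * real n) \<le> weight p q l c n \<Longrightarrow>
           map (weight p q l c) [0..<n0] = ws \<Longrightarrow> d \<le> weight p q l c n"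
proof
  let ?D = "insert C1 {x \<in> set ws. x > 0}"
  show "Min ?D > 0"
    using assms(1) by (subst Min_gr_iff) auto
  fix p q l c n
  assume k: "deformation_kernel p q l c"
    and g: "\<forall>n\<ge>n0. C1 * exp (lam * real n) \<le> weight p q l c n"
    and ws: "map (weight p q l c) [0..<n0] = ws"
  show "Min ?D \<le> weight p q l c n"
  proof (cases "n < n0")
    case True
    then have "weight p q l c n \<in> set ws"
      unfolding ws[symmetric] by simp
    then show ?thesis
      using weight_pos[OF k, of n] by (intro Min_le) auto
  next
    case False
    have "Min ?D \<le> C1 * 1"
      by (simp add: Min_le)
    also have "\<dots> \<le> C1 * exp (lam * real n)"
      using assms by (intro mult_left_mono) auto
    also have "\<dots> \<le> weight p q l c n"
      using g False by simp
    finally show ?thesis .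
  qed
qed

theorem proposition4p3:
  fixes r :: real
  assumes "r > 0"
  shows
    "(\<forall>p q l c F. deformation_kernel p q l c \<longrightarrow> F \<in> rpq_space p q l c r \<longrightarrow>
        (\<forall>n. norm (fps_nth F n) \<le> rpq_norm p q l c r F / (weight p q l c n * r ^ n)) \<and>
        (\<forall>m. norm ((deriv ^^ m) (eval_fps F) 0) = fact m * norm (fps_nth F m) \<and>
             fact m * norm (fps_nth F m)
               \<le> fact m * (rpq_norm p q l c r F / (weight p q l c m * r ^ m))) \<and>
        (\<forall>\<rho>. 0 < \<rho> \<longrightarrow> \<rho> < r \<longrightarrow>
             ((INF n. weight p q l c n) > 0 \<longrightarrow> ereal \<rho> < fps_conv_radius F) \<and>
             disc_sup \<rho> F
               \<le> ennreal (rpq_norm p q l c r F) / (INF n. ennreal (weight p q l c n))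
                   * (\<Sum>n. ennreal ((\<rho> / r) ^ n)))) \<and>
     (\<forall>\<rho> C1 C2 lam Lam n0 ws.
        0 < \<rho> \<longrightarrow> \<rho> < r \<longrightarrow> 0 < C1 \<longrightarrow> 0 < C2 \<longrightarrow> 0 < lam \<longrightarrow> lam \<le> Lam \<longrightarrow>
        (\<exists>C>0. \<forall>p q l c.
           deformation_kernel p q l c \<longrightarrow>
           (\<forall>n\<ge>n0. C1 * exp (lam * real n) \<le> weight p q l c n \<and>
                   weight p q l c n \<le> C2 * exp (Lam * real n)) \<longrightarrow>
           map (weight p q l c) [0..<n0] = ws \<longrightarrow>
           (\<forall>F \<in> rpq_space p q l c r.
              ereal \<rho> < fps_conv_radius F \<and>
              disc_sup \<rho> F \<le> ennreal (C * rpq_norm p q l c r F))))"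
proof (intro conjI allI impI)
  fix p q l c F
  assume k: "deformation_kernel p q l c" and F: "F \<in> rpq_space p q l c r"
  let ?N = "rpq_norm p q l c r F"
  show coeff: "norm (fps_nth F n) \<le> ?N / (weight p q l c n * r ^ n)" for n
    by (rule coeff_le_rpq_norm[OF k F assms])
  show "norm ((deriv ^^ m) (eval_fps F) 0) = fact m * norm (fps_nth F m)" for m
    using F by (intro norm_deriv_eval_fps_0) (simp add: rpq_space_def)
  show "fact m * norm (fps_nth F m) \<le> fact m * (?N / (weight p q l c m * r ^ m))" for m
    by (intro mult_left_mono coeff) simp
  fix \<rho> :: real
  assume "0 < \<rho>" and "\<rho> < r"
  show "ereal \<rho> < fps_conv_radius F" if "(INF n. weight p q l c n) > 0"
    by (rule less_conv_radius_if_INF_weight_pos[OF k F assms that \<open>\<rho> < r\<close>])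
  have "disc_sup \<rho> F \<le> ennreal ?N / (INF n. ennreal (weight p q l c n)) * 1"
    using disc_sup_le_INF_weight[OF k F assms] \<open>\<rho> < r\<close> by simp
  also have "\<dots> \<le> ennreal ?N / (INF n. ennreal (weight p q l c n)) * (\<Sum>n. ennreal ((\<rho> / r) ^ n))"
    by (intro mult_left_mono one_le_geometric_ennreal) simp
  finally show "disc_sup \<rho> F
    \<le> ennreal ?N / (INF n. ennreal (weight p q l c n)) * (\<Sum>n. ennreal ((\<rho> / r) ^ n))" .
next
  fix \<rho> C1 C2 lam Lam :: real and n0 :: nat and ws :: "real list"
  assume \<rho>: "0 < \<rho>" "\<rho> < r" and pos: "0 < C1" "0 < lam"
  obtain d where d: "d > 0"
    and bound: "\<And>p q l c n. deformation_kernel p q l c \<Longrightarrow>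
           \<forall>n\<ge>n0. C1 * exp (lam * real n) \<le> weight p q l c n \<Longrightarrow>
           map (weight p q l c) [0..<n0] = ws \<Longrightarrow> d \<le> weight p q l c n"
    using common_weight_bound[OF pos, of n0 ws] by blast
  show "\<exists>C>0. \<forall>p q l c.
           deformation_kernel p q l c \<longrightarrow>
           (\<forall>n\<ge>n0. C1 * exp (lam * real n) \<le> weight p q l c n \<and>
                   weight p q l c n \<le> C2 * exp (Lam * real n)) \<longrightarrow>
           map (weight p q l c) [0..<n0] = ws \<longrightarrow>
           (\<forall>F \<in> rpq_space p q l c r.
              ereal \<rho> < fps_conv_radius F \<and>
              disc_sup \<rho> F \<le> ennreal (C * rpq_norm p q l c r F))"
  proof (intro exI[of _ "1 / d"] conjI allI impI ballI)
    show "0 < 1 / d"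
      using d by simp
    fix p q l c F
    assume k: "deformation_kernel p q l c"
      and g: "\<forall>n\<ge>n0. C1 * exp (lam * real n) \<le> weight p q l c n \<and>
                   weight p q l c n \<le> C2 * exp (Lam * real n)"
      and ws: "map (weight p q l c) [0..<n0] = ws"
      and F: "F \<in> rpq_space p q l c r"
    have le: "d \<le> weight p q l c n" for n
      by (rule bound[OF k _ ws]) (use g in blast)
    have "ereal \<rho> < ereal r"
      using \<rho> by simp
    also have "\<dots> \<le> fps_conv_radius F"
      by (rule conv_radius_ge_if_weight_ge[OF F assms d le])
    finally show "ereal \<rho> < fps_conv_radius F" .
    show "disc_sup \<rho> F \<le> ennreal (1 / d * rpq_norm p q l c r F)"
      using disc_sup_le_if_weight_ge[OF F assms d le, of \<rho>] \<rho> by simp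
  qed
qed

end
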